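(* Let $1\le t\le h-1$. Fix $N$ and two nonnegative integers $i,j$ with $i+j\le N$ ($i=0$ if $t=1$, $j=0$ if $t=h-1$). Suppose that $f'_M\in V_{t,M}$ and $f''_{N-M}\in V_{h-t,N-M}$ are defined for $i\le M\le N-j$ and that $$\|f'_M\|^2_{V_{t,M}}=\Gamma'\,\frac{(A_tq^{t+2i};q)_{M-i}}{(q;q)_{M-i}}\,q^{[(M-2i)^2+M+2i-2i^2]/2},$$ $$\|f''_{N-M}\|^2_{V_{h-t,N-M}}=\Gamma''\,\frac{(A_hA_t^{-1}q^{h-t+2j};q)_{N-M-j}}{(q;q)_{N-M-j}}\,q^{[(N-M-2j)^2+N-M+2j-2j^2]/2},$$ where the constants $\Gamma'$ and $\Gamma''$ do not depend on $M$. Let $n,m$ be two nonnegative integers with $i+j\le n\le N$ and $i+j\le m\le N$. For $k\in\{n,m\}$ put $$\psi_{k-i-j}(M,N-M)=Q_{k-i-j}\bigl(M-i;\,A_tq^{t+2i-1},\,A_hA_t^{-1}q^{h-t+2j-1},\,N-i-j\,|\,q\bigr).$$ Define $f,g\in V_{h,N}$ by $$f(\mathbf{x})=q^{-jX_t}\psi_{n-i-j}(X_t,N-X_t)f'_{X_t}(\mathbf{x}')f''_{N-X_t}(\mathbf{x}''),\qquad g(\mathbf{x})=q^{-jX_t}\psi_{m-i-j}(X_t,N-X_t)f'_{X_t}(\mathbf{x}')f''_{N-X_t}(\mathbf{x}'')$$ for all $\mathbf{x}\in[h;N]$ with $i\le X_t\le N-j$, and $f(\mathbf{x})=g(\mathbf{x})=0$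 for all other $\mathbf{x}$. Then $$\langle f,g\rangle_{V_{h,N}}=\delta_{n,m}\,\Gamma\,\frac{(A_hq^{h+2n};q)_{N-n}}{(q;q)_{N-n}}\,q^{[(N-2n)^2+N+2n-2n^2]/2},$$ where $$\Gamma=\Gamma'\,\Gamma''\,\frac{(q;q)_{n-i-j}\,(A_hq^{h+n+i+j-1};q)_{n-i-j}\,(A_hA_t^{-1}q^{h-t+2j};q)_{n-i-j}}{(A_tq^{t+2i};q)_{n-i-j}}\,(A_tq^{t+2i})^{n-i}\,q^{-2ij-(n-i-j)}$$ (and therefore $\Gamma$ does not depend on $N$).
   Context: Let $0<q<1$, let $h\ge2$ and $N\ge1$ be integers, and let $\alpha_1,\dots,\alpha_h$ be real numbers such that either $0<\alpha_i<q^{-1}$ for all $i$, or $\alpha_i>q^{-N}$ for all $i$. Write $(a;q)_k=\prod_{j=0}^{k-1}(1-aq^j)$. For integers $g\ge1$, $M\ge 0$, $[g;M]$ is the set of $\mathbf{x}=(x_1,\dots,x_g)$ with $x_i$ nonnegative integers and $x_1+\cdots+x_g=M$; $V_{g,M}$ is the space of complex functions on $[g;M]$. Put $X_k=x_1+\cdots+x_k$, $A_k=\alpha_1\cdots\alpha_k$. For $M\le N$ the scalar product on $V_{h,M}$ is $$\langle f_1,f_2 \rangle_{V_{h,M}}=q^{M(M+1)/2}\sum_{\mathbf{x}\in [h;M]}\prod_{i=1}^h\left[\frac{(q\alpha_i;q)_{x_i}}{(q;q)_{x_i}}(\alpha_i q)^{M-X_i}\right]f_1(\mathbf{x})\overline{f_2(\mathbf{x})}.$$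 For $\mathbf{x}\in[h;N]$ write $\mathbf{x}'=(x_1,\dots,x_t)$, $\mathbf{x}''=(x_{t+1},\dots,x_h)$. The scalar products on $V_{t,M}$ and on $V_{h-t,N-M}$ are defined by the same formula using the parameters $\alpha_1,\dots,\alpha_t$, respectively $\alpha_{t+1},\dots,\alpha_h$ (relabelled consecutively, with partial sums of the variables $x_{t+1},\dots,x_h$). In all cases $\|f\|^2$ means $\langle f,f\rangle$, and $\delta_{n,m}$ is the Kronecker delta. For integers $0\le n\le N'$ and $0\le x\le N'$ the $q$-Hahn polynomial is $$Q_n(x;\alpha,\beta,N'|q)=q^{-nN'+n^2/2}\frac{(q;q)_{N'}}{(q;q)_{N'-n}}\sum_{k=0}^{n}\frac{(q^{-n};q)_k(\alpha\beta q^{n+1};q)_k(q^{-x};q)_k}{(\alpha q;q)_k(q^{-N'};q)_k(q;q)_k}\,q^k.$$ *)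

theory Defs
  imports Complex_Main "HOL-Library.FuncSet"
begin

definition qpoch :: "real \<Rightarrow> real \<Rightarrow> nat \<Rightarrow> real" where
  "qpoch a q k = (\<Prod>j<k. 1 - a * q ^ j)"

text \<open>Tuples \<open>(x\<^sub>1, \<dots>, x\<^sub>g)\<close> and \<open>(\<alpha>\<^sub>1, \<dots>, \<alpha>\<^sub>h)\<close> are lists, so \<open>x\<^sub>i\<close> is
  \<open>x ! (i - 1)\<close>, and \<open>take t\<close> and \<open>drop t\<close> give the first \<open>t\<close> and the (relabelled)
  remaining entries.\<close>

definition tuples :: "nat \<Rightarrow> nat \<Rightarrow> nat list set" where
  "tuples g M = {x. length x = g \<and> sum_list x = M}"

definition V :: "nat \<Rightarrow> nat \<Rightarrow> (nat list \<Rightarrow> complex) set" where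
  "V g M = tuples g M \<rightarrow>\<^sub>E UNIV"

definition psum :: "nat list \<Rightarrow> nat \<Rightarrow> nat" where
  "psum x k = sum_list (take k x)"

definition pprod :: "real list \<Rightarrow> nat \<Rightarrow> real" where
  "pprod \<alpha> k = prod_list (take k \<alpha>)"

text \<open>The scalar product on \<open>V g M\<close> for the parameters \<open>\<alpha>\<close>, where \<open>g = length \<alpha>\<close>. The
  product index is shifted by one: the factor for \<open>i\<close> contains \<open>\<alpha>\<^sub>i\<^sub>+\<^sub>1\<close>, \<open>x\<^sub>i\<^sub>+\<^sub>1\<close> and
  \<open>X\<^sub>i\<^sub>+\<^sub>1\<close>. The exponent \<open>M - X\<^sub>i\<^sub>+\<^sub>1\<close> is never truncated, as \<open>X\<^sub>i\<^sub>+\<^sub>1 \<le> M\<close> on \<open>tuples g M\<close>.\<close>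

definition scalar_prod ::
  "real \<Rightarrow> real list \<Rightarrow> nat \<Rightarrow> (nat list \<Rightarrow> complex) \<Rightarrow> (nat list \<Rightarrow> complex) \<Rightarrow> complex" where
  "scalar_prod q \<alpha> M f1 f2 =
     of_real (q ^ (M * (M + 1) div 2)) *
     (\<Sum>x\<in>tuples (length \<alpha>) M.
        of_real (\<Prod>i<length \<alpha>. qpoch (q * \<alpha> ! i) q (x ! i) / qpoch q q (x ! i)
                   * (\<alpha> ! i * q) ^ (M - psum x (Suc i)))
        * f1 x * cnj (f2 x))"

text \<open>The q-Hahn polynomial \<open>Q\<^sub>n(x; a, b, N | q)\<close>, meaningful for \<open>n \<le> N\<close> and \<open>x \<le> N\<close>.\<close>

definition qHahn :: "nat \<Rightarrow> nat \<Rightarrow> real \<Rightarrow> real \<Rightarrow> nat \<Rightarrow> real \<Rightarrow> real" where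
  "qHahn n x a b N q =
     q powr (- real n * real N + (real n)\<^sup>2 / 2) * (qpoch q q N / qpoch q q (N - n)) *
     (\<Sum>k=0..n. qpoch (q powi (- int n)) q k * qpoch (a * b * q ^ (n + 1)) q k
                  * qpoch (q powi (- int x)) q k
                / (qpoch (a * q) q k * qpoch (q powi (- int N)) q k * qpoch q q k) * q ^ k)"

text \<open>The constant \<open>\<Gamma>\<close>, for \<open>h = length \<alpha>\<close>. There is no argument \<open>N\<close>, so \<open>\<Gamma>\<close> does not
  depend on it.\<close>

definition Gamma_const ::
  "real \<Rightarrow> real list \<Rightarrow> nat \<Rightarrow> nat \<Rightarrow> nat \<Rightarrow> nat \<Rightarrow> real \<Rightarrow> real \<Rightarrow> real" where
  "Gamma_const q \<alpha> t i j n \<Gamma>' \<Gamma>'' =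
     (let h = length \<alpha>; A = pprod \<alpha> in
      \<Gamma>' * \<Gamma>'' *
      (qpoch q q (n - i - j) * qpoch (A h * q ^ (h + n + i + j - 1)) q (n - i - j)
         * qpoch (A h * inverse (A t) * q ^ (h - t + 2 * j)) q (n - i - j)
       / qpoch (A t * q ^ (t + 2 * i)) q (n - i - j)) *
      (A t * q ^ (t + 2 * i)) ^ (n - i) *
      q powi (- 2 * int i * int j - (int n - int i - int j)))"

end

theory Submission
  imports Defs "HOL-Computational_Algebra.Polynomial"
begin

text \<open>Since \<open>N - X\<^sub>k = (N - M) + (M - X\<^sub>k)\<close> for \<open>k \<le> t\<close> and \<open>M = X\<^sub>t\<close>, the weight on \<open>[h;N]\<close> is the product
  of the weights on \<open>[t;M]\<close> and \<open>[h-t;N-M]\<close>, up to a factor depending on \<open>M\<close> only. Summing first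
  over \<open>x'\<close> and \<open>x''\<close> turns \<open>\<langle>f,g\<rangle>\<close> into the scalar product of two q-Hahn polynomials.

  For their orthogonality, pair the degree \<open>n\<close> polynomial with \<open>(b q\<^sup>L\<^sup>-\<^sup>x\<^sup>+\<^sup>1;q)\<^sub>s\<close>, which has degree \<open>s\<close> in
  \<open>q\<^sup>-\<^sup>x\<close> and is absorbed by the factor \<open>(b q;q)\<^sub>L\<^sub>-\<^sub>x\<close> of the weight. The sum over \<open>x\<close> is then a
  q-Vandermonde sum and the remaining one a q-Chu-Vandermonde sum, equal to a product which is \<open>0\<close>
  for \<open>s < n\<close>. So only the leading coefficient of the second polynomial matters.\<close>

section \<open>q-Vandermonde summation\<close>

lemma qpoch_0 [simp]: "qpoch a q 0 = 1"
  by (simp add: qpoch_def)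

lemma qpoch_Suc: "qpoch a q (Suc k) = qpoch a q k * (1 - a * q ^ k)"
  by (simp add: qpoch_def)

lemma qpoch_add: "qpoch a q (k + l) = qpoch a q k * qpoch (a * q ^ k) q l"
  by (induction l) (simp_all add: qpoch_Suc power_add mult_ac)

lemma qpoch_Suc_left: "qpoch a q (Suc k) = (1 - a) * qpoch (a * q) q k"
  using qpoch_add[of a q 1 k] by (simp add: qpoch_Suc)

lemma qpoch_eq_0_iff: "qpoch a q k = 0 \<longleftrightarrow> (\<exists>j<k. a * q ^ j = 1)"
  by (auto simp: qpoch_def)

lemma one_minus_power_nz: "1 - q * q ^ k \<noteq> 0" if "0 < q" "q < 1" for q :: real
  using power_Suc_less_one[OF that(1,2), of k] by auto

lemma qpoch_self_nz: "qpoch q q k \<noteq> 0" if "0 < q" "q < 1"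
  using one_minus_power_nz[OF that] by (auto simp: qpoch_eq_0_iff)

lemma qpoch_neg_power_nz:
  assumes "0 < q" "q < 1" "k \<le> L"
  shows "qpoch (inverse (q ^ L)) q k \<noteq> 0"
proof -
  have "inverse (q ^ L) * q ^ j \<noteq> 1" if "j < k" for j
    using that assms power_strict_decreasing[of j L q] by (fastforce simp: field_simps)
  then show ?thesis
    by (auto simp: qpoch_eq_0_iff)
qed

lemma qpoch_neg_power_eq_0: "qpoch (inverse (q ^ x)) q k = 0" if "q \<noteq> 0" "x < k"
  using that by (auto simp: qpoch_eq_0_iff)

lemma qpoch_neg_power_Suc:
  assumes "q \<noteq> 0"
  shows "qpoch (inverse (q ^ Suc n)) q (Suc k)
         = (1 - inverse (q ^ Suc n)) * qpoch (inverse (q ^ n)) q k"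
proof -
  have "inverse (q ^ Suc n) * q = inverse (q ^ n)"
    using assms by simp
  then show ?thesis
    by (simp only: qpoch_Suc_left)
qed

text \<open>Factor by factor, \<open>1 - q^(j-l) = -q^(j-l) (1 - q^(l-j))\<close> with
  \<open>l = k + y\<close>. The signs and the remaining powers \<open>q^j\<close> stay an
  unevaluated product: the same product is the leading coefficient of \<open>(u;q)_k\<close> in
  \<open>u\<close>, and the two cancel later.\<close>

lemma qpoch_neg_power_mult:
  assumes "q \<noteq> 0"
  shows "qpoch (inverse (q ^ (k + y))) q k * qpoch q q y * q ^ (k * (k + y))
         = qpoch q q (k + y) * (\<Prod>j<k. - (q ^ j))"
proof (induction k)
  case (Suc k)
  have ring_arith: "p * r * c * (s * t * u) = (p * s) * t * (r * c * u)" for p r c s t u :: real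
    by (simp add: mult_ac)
  \<comment> \<open>Removing the first factor rather than the last leaves \<open>y\<close>
    unchanged, so the induction hypothesis applies.\<close>
  have "qpoch (inverse (q ^ (Suc k + y))) q (Suc k)
      = (1 - inverse (q ^ (Suc k + y))) * qpoch (inverse (q ^ (k + y))) q k"
    using qpoch_neg_power_Suc[OF assms, of "k + y" k] by simp
  moreover have "q ^ (Suc k * (Suc k + y)) = q ^ (Suc k + y) * q ^ k * q ^ (k * (k + y))"
    by (simp add: power_add algebra_simps)
  moreover have "(1 - inverse (q ^ (Suc k + y))) * q ^ (Suc k + y) = - (1 - q * q ^ (k + y))"
    using assms by (simp add: algebra_simps)
  ultimately have "qpoch (inverse (q ^ (Suc k + y))) q (Suc k) * qpoch q q y * q ^ (Suc k * (Suc k + y))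
     = - (1 - q * q ^ (k + y)) * q ^ k
         * (qpoch (inverse (q ^ (k + y))) q k * qpoch q q y * q ^ (k * (k + y)))"
    by (simp only: ring_arith)
  also have "\<dots> = qpoch q q (Suc k + y) * (\<Prod>j<Suc k. - (q ^ j))"
    unfolding Suc by (simp add: qpoch_Suc algebra_simps)
  finally show ?case .
qed simp

text \<open>In generating functions this is the coefficient of \<open>z^K\<close> in
  \<open>(Az;q)_\<infinity>/(z;q)_\<infinity>\<close> times
  \<open>(ABz;q)_\<infinity>/(Az;q)_\<infinity>\<close>, where the middle factor cancels. The proof
  stays finite: both sides satisfy \<open>(1 - q^(K+1)) F (K+1) = (1 - A B q^K) F K\<close>.\<close>

lemma q_Vandermonde:
  assumes "0 < q" "q < 1"
  shows "(\<Sum>y\<le>K. qpoch A q y / qpoch q q y * (qpoch B q (K - y) / qpoch q q (K - y)) * A ^ (K - y))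
         = qpoch (A * B) q K / qpoch q q K"
proof (induction K)
  case (Suc K)
  define e where "e a y = qpoch a q y / qpoch q q y" for a y
  define F where "F K = (\<Sum>y\<le>K. e A y * e B (K - y) * A ^ (K - y))" for K
  have e_Suc: "(1 - q * q ^ y) * e a (Suc y) = (1 - a * q ^ y) * e a y" for a y
    using one_minus_power_nz[OF assms, of y] by (simp add: e_def qpoch_Suc)
  \<comment> \<open>Split \<open>1 - q^(K+1) = (1 - q^y) + q^y (1 - q^(K+1-y))\<close>. By
    \<open>e_Suc\<close> the first part lowers the index of \<open>e A\<close>, the second that of
    \<open>e B\<close>.\<close>
  have "(1 - q * q ^ K) * F (Suc K)
      = (\<Sum>y\<le>Suc K. (1 - q ^ y) * e A y * e B (Suc K - y) * A ^ (Suc K - y))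
      + (\<Sum>y\<le>Suc K. q ^ y * e A y * ((1 - q ^ (Suc K - y)) * e B (Suc K - y)) * A ^ (Suc K - y))"
    unfolding F_def sum_distrib_left sum.distrib[symmetric]
  proof (rule sum.cong)
    fix y assume "y \<in> {..Suc K}"
    then have "q * q ^ K = q ^ y * q ^ (Suc K - y)"
      by (simp flip: power_add power_Suc)
    then show "(1 - q * q ^ K) * (e A y * e B (Suc K - y) * A ^ (Suc K - y))
      = (1 - q ^ y) * e A y * e B (Suc K - y) * A ^ (Suc K - y)
      + q ^ y * e A y * ((1 - q ^ (Suc K - y)) * e B (Suc K - y)) * A ^ (Suc K - y)"
      by (simp add: algebra_simps)
  qed simp
  also have "(\<Sum>y\<le>Suc K. (1 - q ^ y) * e A y * e B (Suc K - y) * A ^ (Suc K - y))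
      = (\<Sum>y\<le>K. (1 - A * q ^ y) * (e A y * e B (K - y) * A ^ (K - y)))"
    by (subst sum.atMost_Suc_shift) (simp add: e_Suc mult.assoc)
  also have "(\<Sum>y\<le>Suc K. q ^ y * e A y * ((1 - q ^ (Suc K - y)) * e B (Suc K - y)) * A ^ (Suc K - y))
      = (\<Sum>y\<le>K. q ^ y * A * (1 - B * q ^ (K - y)) * (e A y * e B (K - y) * A ^ (K - y)))"
    by (auto simp: Suc_diff_le e_Suc intro!: sum.cong)
  \<comment> \<open>The two coefficients add up to \<open>1 - A B q^K\<close>, which no longer
    depends on \<open>y\<close>.\<close>
  also have "(\<Sum>y\<le>K. (1 - A * q ^ y) * (e A y * e B (K - y) * A ^ (K - y))) + \<dots>
      = (1 - A * B * q ^ K) * F K"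
    unfolding F_def sum_distrib_left sum.distrib[symmetric]
  proof (rule sum.cong)
    fix y assume "y \<in> {..K}"
    then have "q ^ K = q ^ y * q ^ (K - y)"
      by (simp flip: power_add)
    then show "(1 - A * q ^ y) * (e A y * e B (K - y) * A ^ (K - y))
        + q ^ y * A * (1 - B * q ^ (K - y)) * (e A y * e B (K - y) * A ^ (K - y))
      = (1 - A * B * q ^ K) * (e A y * e B (K - y) * A ^ (K - y))"
      by (simp add: algebra_simps)
  qed simp
  also have "F K = qpoch (A * B) q K / qpoch q q K"
    using Suc by (simp add: F_def e_def)
  finally have "F (Suc K) = qpoch (A * B) q (Suc K) / qpoch q q (Suc K)"
    using one_minus_power_nz[OF assms, of K] qpoch_self_nz[OF assms, of K]
    by (simp add: qpoch_Suc field_simps)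
  then show ?case
    by (simp add: F_def e_def)
qed simp

text \<open>The q-Chu-Vandermonde sum for \<open>2\<phi>1(q\<^sup>-\<^sup>n, B; C; q, q)\<close>, multiplied by \<open>(C;q)\<^sub>n\<close> so that
  \<open>C\<close> is unrestricted.\<close>

lemma q_Chu_Vandermonde:
  assumes "0 < q" "q < 1"
  shows "(\<Sum>k\<le>n. qpoch (inverse (q ^ n)) q k * q ^ k / qpoch q q k
                  * qpoch B q k * qpoch (C * q ^ k) q (n - k))
         = (\<Prod>j<n. B - C * q ^ j)"
proof (induction n arbitrary: C)
  case (Suc n)
  have ring_arith: "x * y * z * (u * r) - x * y * (z * v) * r = x * (u - v) * (y * z * r)"
    for x y z u v r :: real
    by (simp add: algebra_simps)
  define g where "g n k = qpoch (inverse (q ^ n)) q k * q ^ k / qpoch q q k" for n k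
  have g_0: "g n 0 = 1" for n
    by (simp add: g_def)
  have g_beyond: "g n (Suc n) = 0"
    using assms by (simp add: g_def qpoch_neg_power_eq_0)
  \<comment> \<open>\<open>g n k\<close> is a q-binomial coefficient up to a sign and a power of
    \<open>q\<close>, and this is its Pascal rule. It expresses row \<open>n + 1\<close> through row
    \<open>n\<close>.\<close>
  have g_rec: "g (Suc n) (Suc k) = inverse (q ^ Suc k) * g n (Suc k) - inverse (q ^ k) * g n k" for k
  proof -
    define P where "P = qpoch (inverse (q ^ n)) q k / qpoch q q k"
    have nz: "q ^ k \<noteq> 0" "q ^ n \<noteq> 0" "1 - q * q ^ k \<noteq> 0" "q \<noteq> 0"
      using assms one_minus_power_nz[OF assms] by auto
    have "g (Suc n) (Suc k) = P * (1 - inverse (q * q ^ n)) * (q * q ^ k) / (1 - q * q ^ k)"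
      unfolding g_def P_def qpoch_neg_power_Suc[OF nz(4)] by (simp add: qpoch_Suc)
    moreover have "g n (Suc k) = P * (1 - inverse (q ^ n) * q ^ k) * (q * q ^ k) / (1 - q * q ^ k)"
      by (simp add: g_def P_def qpoch_Suc)
    moreover have "g n k = P * q ^ k"
      by (simp add: g_def P_def)
    ultimately show ?thesis
      using nz by (simp only: power_Suc) (simp add: field_simps)
  qed
  have "(\<Sum>k\<le>Suc n. g (Suc n) k * qpoch B q k * qpoch (C * q ^ k) q (Suc n - k))
      = qpoch C q (Suc n)
        + (\<Sum>k\<le>n. inverse (q ^ Suc k) * g n (Suc k) * qpoch B q (Suc k) * qpoch (C * q ^ Suc k) q (n - k))
        - (\<Sum>k\<le>n. inverse (q ^ k) * g n k * qpoch B q (Suc k) * qpoch (C * q ^ Suc k) q (n - k))"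
    by (subst sum.atMost_Suc_shift) (simp add: g_0 g_rec algebra_simps sum_subtractf)
  \<comment> \<open>The separated term is the missing term \<open>k = 0\<close> of the first sum.
    The top term of the completed sum vanishes by \<open>g_beyond\<close>, so both sums run over
    \<open>k \<le> n\<close>.\<close>
  also have "qpoch C q (Suc n)
        + (\<Sum>k\<le>n. inverse (q ^ Suc k) * g n (Suc k) * qpoch B q (Suc k) * qpoch (C * q ^ Suc k) q (n - k))
      = (\<Sum>k\<le>Suc n. inverse (q ^ k) * g n k * qpoch B q k * qpoch (C * q ^ k) q (Suc n - k))"
    by (subst sum.atMost_Suc_shift) (simp add: g_0)
  also have "\<dots> = (\<Sum>k\<le>n. inverse (q ^ k) * g n k * qpoch B q k * qpoch (C * q ^ k) q (Suc n - k))"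
    by (simp add: g_beyond)
  \<comment> \<open>Termwise, \<open>(1 - C q^k) - (1 - B q^k) = (B - C) q^k\<close> cancels
    \<open>inverse (q ^ k)\<close>. What remains is the induction hypothesis with \<open>C q\<close>
    in place of \<open>C\<close>.\<close>
  also have "\<dots> - (\<Sum>k\<le>n. inverse (q ^ k) * g n k * qpoch B q (Suc k) * qpoch (C * q ^ Suc k) q (n - k))
      = (B - C) * (\<Sum>k\<le>n. g n k * qpoch B q k * qpoch (C * q * q ^ k) q (n - k))"
    unfolding sum_subtractf[symmetric] sum_distrib_left
  proof (rule sum.cong)
    fix k assume "k \<in> {..n}"
    then have "qpoch (C * q ^ k) q (Suc n - k) = (1 - C * q ^ k) * qpoch (C * q * q ^ k) q (n - k)"
      by (simp add: Suc_diff_le qpoch_Suc_left mult_ac)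
    moreover have "inverse (q ^ k) * ((1 - C * q ^ k) - (1 - B * q ^ k)) = B - C"
      using assms by (simp add: field_simps)
    moreover have "C * q ^ Suc k = C * q * q ^ k"
      by simp
    ultimately show "inverse (q ^ k) * g n k * qpoch B q k * qpoch (C * q ^ k) q (Suc n - k)
        - inverse (q ^ k) * g n k * qpoch B q (Suc k) * qpoch (C * q ^ Suc k) q (n - k)
      = (B - C) * (g n k * qpoch B q k * qpoch (C * q * q ^ k) q (n - k))"
      by (simp only: qpoch_Suc[of B]) (simp only: ring_arith)
  qed simp
  also have "(\<Sum>k\<le>n. g n k * qpoch B q k * qpoch (C * q * q ^ k) q (n - k))
      = (\<Prod>j<n. B - C * q * q ^ j)"
    unfolding g_def by (rule Suc)
  also have "(B - C) * \<dots> = (\<Prod>j<Suc n. B - C * q ^ j)"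
    by (subst prod.lessThan_Suc_shift) (simp add: mult.assoc)
  finally show ?case
    by (simp add: g_def)
qed simp

section \<open>Orthogonality of the q-Hahn polynomials\<close>

text \<open>For \<open>A = a q\<close> and \<open>B = b q\<close> this is the classical q-Hahn
  weight up to a factor independent of \<open>x\<close>. Written with \<open>L - x\<close>, it is
  the summand of \<open>q_Vandermonde\<close>.\<close>

definition hahn_weight :: "real \<Rightarrow> real \<Rightarrow> real \<Rightarrow> nat \<Rightarrow> nat \<Rightarrow> real" where
  "hahn_weight q A B L x =
     qpoch A q x / qpoch q q x * (qpoch B q (L - x) / qpoch q q (L - x)) * A ^ (L - x)"

text \<open>Both extra factors are absorbed by the weight: \<open>(q^(-x);q)_k\<close> kills the
  terms \<open>x < k\<close> and shortens \<open>(q;q)_x\<close>, turning \<open>A\<close> into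
  \<open>A q^k\<close>, while \<open>(B q^(L-x);q)_s\<close> turns \<open>B\<close> into
  \<open>B q^s\<close>. The sum left over is \<open>q_Vandermonde\<close> of length
  \<open>L - k\<close>.\<close>

lemma hahn_weight_moment:
  assumes q: "0 < q" "q < 1" and "k \<le> L"
  shows "(\<Sum>x\<le>L. hahn_weight q A B L x * qpoch (inverse (q ^ x)) q k * qpoch (B * q ^ (L - x)) q s)
         = qpoch (inverse (q ^ L)) q k * qpoch A q k * qpoch B q s
           * qpoch (A * B * q ^ (k + s)) q (L - k) / qpoch q q L"
proof -
  define K where "K = L - k"
  have L: "L = k + K"
    using assms by (simp add: K_def)
  define \<sigma> where "\<sigma> = (\<Prod>j<k. - (q ^ j))"
  have nz: "qpoch q q l \<noteq> 0" "q ^ l \<noteq> 0" for l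
    using q qpoch_self_nz by auto
  have neg: "qpoch (inverse (q ^ (k + y))) q k = qpoch q q (k + y) * \<sigma> / (qpoch q q y * q ^ (k * (k + y)))" for y
    using qpoch_neg_power_mult[of q k y] nz[of y] nz(2)[of "k * (k + y)"] q
    by (simp add: \<sigma>_def field_simps)
  have "(\<Sum>x\<le>L. hahn_weight q A B L x * qpoch (inverse (q ^ x)) q k * qpoch (B * q ^ (L - x)) q s)
      = (\<Sum>x\<in>{k..L}. hahn_weight q A B L x * qpoch (inverse (q ^ x)) q k * qpoch (B * q ^ (L - x)) q s)"
    using q by (intro sum.mono_neutral_right) (auto simp: qpoch_neg_power_eq_0)
  also have "\<dots> = (\<Sum>y\<le>K. hahn_weight q A B L (k + y) * qpoch (inverse (q ^ (k + y))) q k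
                          * qpoch (B * q ^ (K - y)) q s)"
    by (rule sum.reindex_bij_witness[of _ "\<lambda>y. k + y" "\<lambda>x. x - k"]) (auto simp: L add.commute)
  also have "\<dots> = (\<Sum>y\<le>K. \<sigma> / q ^ (k * L) * qpoch A q k * qpoch B q s *
      (qpoch (A * q ^ k) q y / qpoch q q y * (qpoch (B * q ^ s) q (K - y) / qpoch q q (K - y))
        * (A * q ^ k) ^ (K - y)))"
  proof (rule sum.cong)
    fix y assume "y \<in> {..K}"
    then obtain z where z: "K = y + z"
      by (auto simp: le_iff_add)
    \<comment> \<open>Both sides are \<open>(B;q)_(z+s)\<close>, split once after \<open>z\<close>
      and once after \<open>s\<close> factors.\<close>
    have B: "qpoch B q z * qpoch (B * q ^ z) q s = qpoch B q s * qpoch (B * q ^ s) q z"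
      using qpoch_add[of B q z s] qpoch_add[of B q s z] by (simp add: add.commute)
    \<comment> \<open>As \<open>L = k + y + z\<close>, pulling out \<open>q^(k L)\<close> in place
      of \<open>q^(k (k + y))\<close> releases the factor \<open>q^(k z)\<close> that completes
      \<open>A^z\<close> to \<open>(A q^k)^z\<close>.\<close>
    have pow: "q ^ (k * L) = q ^ (k * (k + y)) * (q ^ k) ^ z"
      by (simp add: L z flip: power_add power_mult) (simp add: algebra_simps)
    have "hahn_weight q A B L (k + y) * qpoch (inverse (q ^ (k + y))) q k * qpoch (B * q ^ (K - y)) q s
        = qpoch A q k * qpoch (A * q ^ k) q y / qpoch q q z * A ^ z * \<sigma> / (qpoch q q y * q ^ (k * (k + y)))
          * (qpoch B q z * qpoch (B * q ^ z) q s)"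
      using nz(1)[of "k + y"] by (simp add: hahn_weight_def L z neg qpoch_add[of A])
    also have "\<dots> = \<sigma> / q ^ (k * L) * qpoch A q k * qpoch B q s *
      (qpoch (A * q ^ k) q y / qpoch q q y * (qpoch (B * q ^ s) q z / qpoch q q z) * (A * q ^ k) ^ z)"
      unfolding B pow using q by (simp add: power_mult_distrib mult_ac)
    finally show "hahn_weight q A B L (k + y) * qpoch (inverse (q ^ (k + y))) q k * qpoch (B * q ^ (K - y)) q s
        = \<sigma> / q ^ (k * L) * qpoch A q k * qpoch B q s *
      (qpoch (A * q ^ k) q y / qpoch q q y * (qpoch (B * q ^ s) q (K - y) / qpoch q q (K - y))
        * (A * q ^ k) ^ (K - y))"
      by (simp add: z)
  qed simp
  also have "\<dots> = \<sigma> / q ^ (k * L) * qpoch A q k * qpoch B q s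
      * (qpoch (A * q ^ k * (B * q ^ s)) q K / qpoch q q K)"
    unfolding sum_distrib_left[symmetric] q_Vandermonde[OF q] ..
  also have "A * q ^ k * (B * q ^ s) = A * B * q ^ (k + s)"
    by (simp add: power_add)
  also have "\<sigma> / q ^ (k * L) = qpoch (inverse (q ^ L)) q k * qpoch q q K / qpoch q q L"
    using neg[of K] nz(1)[of K] nz(1)[of L] by (simp add: L)
  finally show ?thesis
    using nz(1)[of K] by (simp add: K_def)
qed

section \<open>Polynomials in \<open>u = q^(-x)\<close> and their leading coefficients\<close>

definition qpoch_poly :: "real \<Rightarrow> real \<Rightarrow> nat \<Rightarrow> real poly" where
  "qpoch_poly c q k = (\<Prod>j<k. [:1, - (c * q ^ j):])"

lemma poly_qpoch_poly [simp]: "poly (qpoch_poly c q k) u = qpoch (c * u) q k"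
  by (simp add: qpoch_poly_def qpoch_def poly_prod mult_ac)

lemma degree_qpoch_poly:
  assumes "c \<noteq> 0" "q \<noteq> 0"
  shows "degree (qpoch_poly c q k) = k"
  unfolding qpoch_poly_def using assms by (subst degree_prod_eq_sum_degree) auto

lemma coeff_qpoch_poly:
  assumes "c \<noteq> 0" "q \<noteq> 0"
  shows "coeff (qpoch_poly c q k) k = c ^ k * (\<Prod>j<k. - (q ^ j))"
proof -
  have "lead_coeff (qpoch_poly c q k) = (\<Prod>j<k. - (c * q ^ j))"
    unfolding qpoch_poly_def lead_coeff_prod using assms by simp
  also have "\<dots> = (\<Prod>j<k. c * - (q ^ j))"
    by simp
  also have "\<dots> = c ^ k * (\<Prod>j<k. - (q ^ j))"
    unfolding prod.distrib by simp
  finally show ?thesis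
    by (simp add: degree_qpoch_poly[OF assms])
qed

text \<open>The \<open>r s\<close> form a basis with one element of each degree, and
  \<open>\<Lambda>\<close> kills those of degree below \<open>n\<close>. On degree at most
  \<open>n\<close> it therefore sees only the component along \<open>r n\<close>, which is read off
  from the coefficient of degree \<open>n\<close>.\<close>

lemma functional_eq_lead_coeff:
  fixes \<Lambda> :: "real poly \<Rightarrow> real" and r :: "nat \<Rightarrow> real poly"
  assumes diff: "\<And>p p'. \<Lambda> (p - p') = \<Lambda> p - \<Lambda> p'" and smult: "\<And>c p. \<Lambda> (smult c p) = c * \<Lambda> p"
    and deg: "\<And>s. degree (r s) = s" and nz: "\<And>s. r s \<noteq> 0"
    and vanish: "\<And>s. s < n \<Longrightarrow> \<Lambda> (r s) = 0"
  shows "degree p \<le> n \<Longrightarrow> \<Lambda> p = coeff p n / coeff (r n) n * \<Lambda> (r n)"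
proof (induction "degree p" arbitrary: p rule: less_induct)
  case less
  define d where "d = degree p"
  have lead: "coeff (r d) d \<noteq> 0"
    using nz[of d] deg[of d] leading_coeff_0_iff[of "r d"] by simp
  define p' where "p' = p - smult (coeff p d / coeff (r d) d) (r d)"
  have "\<Lambda> p' = 0"
  \<comment> \<open>The zero polynomial is treated apart: its degree is 0, which is not below
    \<open>d\<close> when \<open>d = 0\<close>.\<close>
  proof (cases "p' = 0")
    case True
    then show ?thesis
      using smult[of 0 0] by simp
  next
    case False
    have "degree p' \<le> d"
      unfolding p'_def by (intro degree_diff_le) (auto simp: d_def deg)
    moreover have "coeff p' d = 0"
      using lead by (simp add: p'_def)
    ultimately have "degree p' < d"
      using False by (metis le_neq_implies_less leading_coeff_0_iff)
    moreover from this have "coeff p' n = 0"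
      using less.prems by (intro coeff_eq_0) (simp add: d_def)
    ultimately show ?thesis
      using less.hyps[of p'] less.prems by (simp add: d_def)
  qed
  then have "\<Lambda> p = coeff p d / coeff (r d) d * \<Lambda> (r d)"
    unfolding p'_def diff smult by simp
  \<comment> \<open>For \<open>d < n\<close> both sides are 0, the left because
    \<open>\<Lambda> (r d) = 0\<close> and the right because \<open>p\<close> has no term of degree
    \<open>n\<close>.\<close>
  also have "\<dots> = coeff p n / coeff (r n) n * \<Lambda> (r n)"
  proof (cases "d = n")
    case False
    then have "d < n"
      using less.prems by (simp add: d_def)
    then show ?thesis
      using vanish[of d] by (simp add: d_def coeff_eq_0)
  qed simp
  finally show ?case .
qed

text \<open>Only the hypergeometric sum of \<open>qHahn\<close> is kept, without its prefactor, and
  \<open>q^(-x)\<close> becomes the variable, so that degree and leading coefficient are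
  available.\<close>

definition hahn_poly :: "real \<Rightarrow> nat \<Rightarrow> real \<Rightarrow> real \<Rightarrow> nat \<Rightarrow> real poly" where
  "hahn_poly q n a b L =
     (\<Sum>k\<le>n. smult (qpoch (inverse (q ^ n)) q k * qpoch (a * b * q ^ (n + 1)) q k
        / (qpoch (a * q) q k * qpoch (inverse (q ^ L)) q k * qpoch q q k) * q ^ k) (qpoch_poly 1 q k))"

lemma qHahn_eq_poly:
  "qHahn n x a b L q = q powr (- real n * real L + (real n)\<^sup>2 / 2) * (qpoch q q L / qpoch q q (L - n))
     * poly (hahn_poly q n a b L) (inverse (q ^ x))"
  by (simp add: qHahn_def hahn_poly_def poly_sum power_int_minus atMost_atLeast0 algebra_simps)

lemma degree_hahn_poly: "q \<noteq> 0 \<Longrightarrow> degree (hahn_poly q n a b L) \<le> n"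
  unfolding hahn_poly_def
  by (intro degree_sum_le) (auto intro!: order.trans[OF degree_smult_le] simp: degree_qpoch_poly)

lemma coeff_hahn_poly:
  assumes "q \<noteq> 0"
  shows "coeff (hahn_poly q n a b L) n
         = qpoch (inverse (q ^ n)) q n * qpoch (a * b * q ^ (n + 1)) q n
           / (qpoch (a * q) q n * qpoch (inverse (q ^ L)) q n * qpoch q q n) * q ^ n * (\<Prod>j<n. - (q ^ j))"
proof -
  have "coeff (qpoch_poly 1 q k) n = 0" if "k < n" for k
    using that assms by (simp add: coeff_eq_0 degree_qpoch_poly)
  then have "coeff (hahn_poly q n a b L) n
      = qpoch (inverse (q ^ n)) q n * qpoch (a * b * q ^ (n + 1)) q n
           / (qpoch (a * q) q n * qpoch (inverse (q ^ L)) q n * qpoch q q n) * q ^ n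
           * coeff (qpoch_poly 1 q n) n"
    unfolding hahn_poly_def coeff_sum
    by (subst sum.mono_neutral_right[of _ "{n}"]) auto
  then show ?thesis
    using assms by (simp add: coeff_qpoch_poly)
qed

text \<open>After exchanging the sums, the inner one is \<open>hahn_weight_moment\<close>, whose
  factors \<open>(a q;q)_k\<close> and \<open>(q^(-L);q)_k\<close> cancel the denominators of the
  polynomial. The outer one is \<open>q_Chu_Vandermonde\<close> with \<open>B = a b q^(n+1)\<close>
  and \<open>C = a b q^(s+2)\<close>.\<close>

lemma hahn_poly_pairing:
  assumes q: "0 < q" "q < 1" and "n \<le> L" and nz: "qpoch (a * q) q n \<noteq> 0"
  shows "(\<Sum>x\<le>L. hahn_weight q (a * q) (b * q) L x * poly (hahn_poly q n a b L) (inverse (q ^ x))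
                  * qpoch (b * q * q ^ (L - x)) q s)
         = qpoch (b * q) q s * qpoch (a * b * q ^ (n + s + 2)) q (L - n) / qpoch q q L
           * (\<Prod>j<n. a * b * q ^ (n + 1) - a * b * q ^ (s + 2) * q ^ j)"
proof -
  have "(\<Sum>x\<le>L. hahn_weight q (a * q) (b * q) L x * poly (hahn_poly q n a b L) (inverse (q ^ x))
                  * qpoch (b * q * q ^ (L - x)) q s)
      = (\<Sum>k\<le>n. (qpoch (inverse (q ^ n)) q k * qpoch (a * b * q ^ (n + 1)) q k
          / (qpoch (a * q) q k * qpoch (inverse (q ^ L)) q k * qpoch q q k) * q ^ k)
          * (\<Sum>x\<le>L. hahn_weight q (a * q) (b * q) L x * qpoch (inverse (q ^ x)) q k
                  * qpoch (b * q * q ^ (L - x)) q s))"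
    unfolding sum_distrib_left
    by (subst sum.swap)
      (simp add: hahn_poly_def poly_sum sum_distrib_left sum_distrib_right mult_ac)
  also have "\<dots> = (\<Sum>k\<le>n. qpoch (b * q) q s * qpoch (a * b * q ^ (n + s + 2)) q (L - n) / qpoch q q L
      * (qpoch (inverse (q ^ n)) q k * q ^ k / qpoch q q k
         * qpoch (a * b * q ^ (n + 1)) q k * qpoch (a * b * q ^ (s + 2) * q ^ k) q (n - k)))"
  proof (rule sum.cong)
    fix k assume "k \<in> {..n}"
    then have k: "k \<le> n" "k \<le> L"
      using assms by auto
    have "qpoch (a * q) q k \<noteq> 0"
      using nz k by (auto simp: qpoch_eq_0_iff)
    moreover have "qpoch (inverse (q ^ L)) q k \<noteq> 0"
      using q k by (simp add: qpoch_neg_power_nz)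
    \<comment> \<open>Cutting after \<open>n - k\<close> factors yields the factor required by
      \<open>q_Chu_Vandermonde\<close> and a rest independent of \<open>k\<close>.\<close>
    moreover have "qpoch (a * q * (b * q) * q ^ (k + s)) q (L - k)
        = qpoch (a * b * q ^ (s + 2) * q ^ k) q (n - k) * qpoch (a * b * q ^ (n + s + 2)) q (L - n)"
    proof -
      have "a * q * (b * q) * q ^ (k + s) = a * b * q ^ (s + 2) * q ^ k"
        "a * b * q ^ (s + 2) * q ^ k * q ^ (n - k) = a * b * q ^ (n + s + 2)"
        using k by (auto simp: power_add power2_eq_square dest!: le_Suc_ex)
      moreover have "L - k = (n - k) + (L - n)"
        using k \<open>n \<le> L\<close> by simp
      ultimately show ?thesis
        by (simp only: qpoch_add)
    qed
    ultimately show "qpoch (inverse (q ^ n)) q k * qpoch (a * b * q ^ (n + 1)) q k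
          / (qpoch (a * q) q k * qpoch (inverse (q ^ L)) q k * qpoch q q k) * q ^ k
          * (\<Sum>x\<le>L. hahn_weight q (a * q) (b * q) L x * qpoch (inverse (q ^ x)) q k
                  * qpoch (b * q * q ^ (L - x)) q s)
      = qpoch (b * q) q s * qpoch (a * b * q ^ (n + s + 2)) q (L - n) / qpoch q q L
      * (qpoch (inverse (q ^ n)) q k * q ^ k / qpoch q q k
         * qpoch (a * b * q ^ (n + 1)) q k * qpoch (a * b * q ^ (s + 2) * q ^ k) q (n - k))"
      unfolding hahn_weight_moment[OF q k(2)] by (simp add: mult_ac)
  qed simp
  finally show ?thesis
    unfolding sum_distrib_left[symmetric] q_Chu_Vandermonde[OF q] .
qed

text \<open>The bound \<open>m \<le> n\<close> makes \<open>functional_eq_lead_coeff\<close>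
  applicable to the second polynomial; the opposite case is reached by symmetry in
  \<open>qHahn_orthogonal\<close>.\<close>

lemma hahn_poly_orthogonal:
  assumes q: "0 < q" "q < 1" and "n \<le> L" and nz: "qpoch (a * q) q n \<noteq> 0" and "b \<noteq> 0" and "m \<le> n"
  shows "(\<Sum>x\<le>L. hahn_weight q (a * q) (b * q) L x * poly (hahn_poly q n a b L) (inverse (q ^ x))
                  * poly (hahn_poly q m a b L) (inverse (q ^ x)))
         = (if n = m then 1 else 0) * (a * q) ^ n * qpoch q q n * qpoch q q (L - n) / (qpoch q q L)\<^sup>2
           * (qpoch (a * b * q ^ (n + 1)) q n * qpoch (b * q) q n / qpoch (a * q) q n)
           * qpoch (a * b * q ^ (2 * n + 2)) q (L - n)"
proof -
  define \<Lambda> where "\<Lambda> p = (\<Sum>x\<le>L. hahn_weight q (a * q) (b * q) L x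
      * poly (hahn_poly q n a b L) (inverse (q ^ x)) * poly p (inverse (q ^ x)))" for p
  \<comment> \<open>At \<open>u = q^(-x)\<close> this is \<open>(b q^(L-x+1);q)_s\<close>, the
    factor that the weight absorbs. Its degree is exactly \<open>s\<close> because
    \<open>b \<noteq> 0\<close>.\<close>
  define r where "r s = qpoch_poly (b * q * q ^ L) q s" for s
  define \<sigma> where "\<sigma> = (\<Prod>j<n. - (q ^ j))"
  have nz': "qpoch q q l \<noteq> 0" "q \<noteq> 0" "b * q * q ^ L \<noteq> 0" "\<sigma> \<noteq> 0" for l
    using q qpoch_self_nz assms by (auto simp: \<sigma>_def)
  have "\<Lambda> (r s) = (\<Sum>x\<le>L. hahn_weight q (a * q) (b * q) L x * poly (hahn_poly q n a b L) (inverse (q ^ x))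
                  * qpoch (b * q * q ^ (L - x)) q s)" for s
    unfolding \<Lambda>_def r_def using nz'
    by (intro sum.cong) (auto simp: power_diff field_simps)
  then have \<Lambda>_r: "\<Lambda> (r s) = qpoch (b * q) q s * qpoch (a * b * q ^ (n + s + 2)) q (L - n) / qpoch q q L
           * (\<Prod>j<n. a * b * q ^ (n + 1) - a * b * q ^ (s + 2) * q ^ j)" for s
    by (simp add: hahn_poly_pairing[OF q \<open>n \<le> L\<close> nz])
  have "\<Lambda> (hahn_poly q m a b L) = coeff (hahn_poly q m a b L) n / coeff (r n) n * \<Lambda> (r n)"
  proof (rule functional_eq_lead_coeff)
    show "\<Lambda> (p - p') = \<Lambda> p - \<Lambda> p'" for p p'
      by (simp add: \<Lambda>_def algebra_simps sum_subtractf)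
    show "\<Lambda> (smult c p) = c * \<Lambda> p" for c p
      by (simp add: \<Lambda>_def sum_distrib_left mult_ac)
    show "degree (r s) = s" for s
      unfolding r_def using nz' by (intro degree_qpoch_poly)
    show "r s \<noteq> 0" for s
      unfolding r_def qpoch_poly_def by simp
    show "degree (hahn_poly q m a b L) \<le> n"
      using degree_hahn_poly[OF nz'(2)] \<open>m \<le> n\<close> by (rule order.trans)
    show "\<Lambda> (r s) = 0" if "s < n" for s
    proof -
      \<comment> \<open>The factor with \<open>j = n - s - 1\<close> vanishes, since then
        \<open>s + 2 + j = n + 1\<close>; \<open>s < n\<close> puts this index in range.\<close>
      have "q ^ (n + 1) = q ^ (s + 2) * q ^ (n - s - 1)"
        using that by (simp flip: power_add power_Suc)
      then have "(\<Prod>j<n. a * b * q ^ (n + 1) - a * b * q ^ (s + 2) * q ^ j) = 0"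
        using that by (intro prod_zero bexI[of _ "n - s - 1"]) auto
      then show ?thesis
        by (simp add: \<Lambda>_r)
    qed
  qed
  also have "\<dots> = (if n = m then 1 else 0) * (a * q) ^ n * qpoch q q n * qpoch q q (L - n) / (qpoch q q L)\<^sup>2
           * (qpoch (a * b * q ^ (n + 1)) q n * qpoch (b * q) q n / qpoch (a * q) q n)
           * qpoch (a * b * q ^ (2 * n + 2)) q (L - n)"
  proof (cases "n = m")
    case False
    then have "coeff (hahn_poly q m a b L) n = 0"
      using degree_hahn_poly[OF nz'(2), of m] \<open>m \<le> n\<close>
      by (intro coeff_eq_0) (metis le_neq_implies_less order.strict_trans1)
    then show ?thesis
      using False by simp
  next
    case True
    have "(\<Prod>j<n. a * b * q ^ (n + 1) - a * b * q ^ (n + 2) * q ^ j)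
        = (\<Prod>j<n. (a * b * q ^ (n + 1)) * (1 - q * q ^ j))"
      by (intro prod.cong) (simp_all add: algebra_simps)
    then have prod: "(\<Prod>j<n. a * b * q ^ (n + 1) - a * b * q ^ (n + 2) * q ^ j)
        = (a * b * q ^ (n + 1)) ^ n * qpoch q q n"
      by (simp only: prod.distrib[of "\<lambda>_. a * b * q ^ (n + 1)"] prod_constant card_lessThan qpoch_def)
    have neg: "qpoch (inverse (q ^ n)) q n = qpoch q q n * \<sigma> / q ^ (n * n)"
      using qpoch_neg_power_mult[OF nz'(2), of n 0] nz' by (simp add: \<sigma>_def field_simps)
    have negL: "qpoch (inverse (q ^ L)) q n = qpoch q q L * \<sigma> / (q ^ (n * L) * qpoch q q (L - n))"
      using qpoch_neg_power_mult[OF nz'(2), of n "L - n"] nz' \<open>n \<le> L\<close>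
      by (simp add: \<sigma>_def field_simps)
    \<comment> \<open>All powers of \<open>q\<close>, \<open>a\<close> and \<open>b\<close> from the
      leading coefficients and the pairing are collected here; their quotient is
      \<open>(a q)^n\<close>.\<close>
    have pow: "q ^ (n * L) * q ^ n * (a * b * q ^ (n + 1)) ^ n
        = (a * q) ^ n * (q ^ (n * n) * (b * q * q ^ L) ^ n)"
      by (simp add: power_mult_distrib flip: power_mult power_add) (simp add: algebra_simps)
    have ratio: "q ^ (n * L) * q ^ n * (a * b * q ^ (n + 1)) ^ n / (q ^ (n * n) * (b * q * q ^ L) ^ n) = (a * q) ^ n"
      using nz' unfolding pow by simp
    have "coeff (hahn_poly q n a b L) n / coeff (r n) n * \<Lambda> (r n)
      = (q ^ (n * L) * q ^ n * (a * b * q ^ (n + 1)) ^ n / (q ^ (n * n) * (b * q * q ^ L) ^ n))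
         * qpoch q q n * qpoch q q (L - n) / (qpoch q q L)\<^sup>2
           * (qpoch (a * b * q ^ (n + 1)) q n * qpoch (b * q) q n / qpoch (a * q) q n)
           * qpoch (a * b * q ^ (2 * n + 2)) q (L - n)"
      unfolding r_def coeff_hahn_poly[OF nz'(2)] coeff_qpoch_poly[OF nz'(3,2)] neg negL
        \<Lambda>_r[unfolded r_def] prod \<sigma>_def[symmetric]
      using nz'(1)[of n] nz'(1)[of L] nz'(4)
      by (simp add: power2_eq_square mult_2 mult_2_right mult_ac)
    then show ?thesis
      unfolding ratio using True by simp
  qed
  finally show ?thesis
    by (simp add: \<Lambda>_def)
qed

lemma qHahn_orthogonal:
  assumes q: "0 < q" "q < 1" and "n \<le> L" "m \<le> L" and nz: "qpoch (a * q) q L \<noteq> 0" and "b \<noteq> 0"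
  shows "(\<Sum>x\<le>L. hahn_weight q (a * q) (b * q) L x * qHahn n x a b L q * qHahn m x a b L q)
         = (if n = m then 1 else 0) * q powr ((real n)\<^sup>2 - 2 * real n * real L)
           * (a * q) ^ n * qpoch q q n
           * (qpoch (a * b * q ^ (n + 1)) q n * qpoch (b * q) q n / qpoch (a * q) q n)
           * (qpoch (a * b * q ^ (2 * n + 2)) q (L - n) / qpoch q q (L - n))"
proof -
  define pre where "pre k = q powr (- real k * real L + (real k)\<^sup>2 / 2) * (qpoch q q L / qpoch q q (L - k))" for k
  define S where "S n m = (\<Sum>x\<le>L. hahn_weight q (a * q) (b * q) L x * poly (hahn_poly q n a b L) (inverse (q ^ x))
                  * poly (hahn_poly q m a b L) (inverse (q ^ x)))" for n m
  \<comment> \<open>Nonvanishing up to \<open>L\<close> passes to both degrees, so the roles of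
    \<open>n\<close> and \<open>m\<close> can be exchanged.\<close>
  have nz': "qpoch (a * q) q k \<noteq> 0" if "k \<le> L" for k
    using nz that by (auto simp: qpoch_eq_0_iff)
  have "(\<Sum>x\<le>L. hahn_weight q (a * q) (b * q) L x * qHahn n x a b L q * qHahn m x a b L q)
      = pre n * pre m * S n m"
    by (simp add: qHahn_eq_poly pre_def S_def sum_distrib_left sum_divide_distrib mult_ac)
  also have "S n m = (if n = m then 1 else 0) * (a * q) ^ n * qpoch q q n * qpoch q q (L - n) / (qpoch q q L)\<^sup>2
           * (qpoch (a * b * q ^ (n + 1)) q n * qpoch (b * q) q n / qpoch (a * q) q n)
           * qpoch (a * b * q ^ (2 * n + 2)) q (L - n)"
  proof (cases "m \<le> n")
    case True
    then show ?thesis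
      unfolding S_def using assms nz' by (intro hahn_poly_orthogonal) auto
  next
    case False
    have "S n m = S m n"
      by (simp add: S_def mult_ac)
    also have "\<dots> = 0"
      unfolding S_def using assms nz' False by (subst hahn_poly_orthogonal) auto
    finally show ?thesis
      using False by simp
  qed
  finally have sum_eq: "(\<Sum>x\<le>L. hahn_weight q (a * q) (b * q) L x * qHahn n x a b L q * qHahn m x a b L q)
      = pre n * pre m * \<dots>" .
  show ?thesis
  proof (cases "n = m")
    case True
    have "q powr (- real n * real L + (real n)\<^sup>2 / 2) * q powr (- real n * real L + (real n)\<^sup>2 / 2)
        = q powr ((real n)\<^sup>2 - 2 * real n * real L)"
      by (simp add: algebra_simps flip: powr_add)
    then have "pre n * pre n = q powr ((real n)\<^sup>2 - 2 * real n * real L) * (qpoch q q L)\<^sup>2 / (qpoch q q (L - n))\<^sup>2"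
      by (simp add: pre_def power2_eq_square)
    then show ?thesis
      using True qpoch_self_nz[OF q, of L] qpoch_self_nz[OF q, of "L - n"] unfolding sum_eq
      by (simp add: power2_eq_square mult_ac)
  qed (simp add: sum_eq)
qed

section \<open>Splitting the scalar product\<close>

lemma finite_tuples [simp]: "finite (tuples g M)"
proof (rule finite_subset)
  show "tuples g M \<subseteq> {x. set x \<subseteq> {..M} \<and> length x = g}"
    by (auto simp: tuples_def member_le_sum_list)
qed (simp add: finite_lists_length_eq)

lemma sum_tuples_append:
  "(\<Sum>x\<in>tuples (a + b) N. F x) = (\<Sum>M\<le>N. \<Sum>y\<in>tuples a M. \<Sum>z\<in>tuples b (N - M). F (y @ z))"
proof -
  have drop: "sum_list (drop a x) = sum_list x - sum_list (take a x)"
    and take: "sum_list (take a x) \<le> sum_list x" for x :: "nat list"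
    using sum_list_append[of "take a x" "drop a x"] by simp_all
  have "(\<Sum>M\<le>N. \<Sum>y\<in>tuples a M. \<Sum>z\<in>tuples b (N - M). F (y @ z))
      = (\<Sum>M\<le>N. \<Sum>p\<in>tuples a M \<times> tuples b (N - M). F (fst p @ snd p))"
    by (simp add: sum.cartesian_product split_beta)
  also have "\<dots> = (\<Sum>p\<in>(SIGMA M:{..N}. tuples a M \<times> tuples b (N - M)). F (fst (snd p) @ snd (snd p)))"
    by (subst sum.Sigma) (auto simp: split_beta)
  also have "\<dots> = (\<Sum>x\<in>tuples (a + b) N. F x)"
    by (rule sum.reindex_bij_witness[of _ "\<lambda>x. (sum_list (take a x), take a x, drop a x)"
          "\<lambda>p. fst (snd p) @ snd (snd p)"])
      (auto simp: tuples_def drop take)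
  finally show ?thesis ..
qed

lemma prod_lessThan_add:
  "(\<Prod>i<a + b. f i) = (\<Prod>i<a. f i) * (\<Prod>i<b. f (a + i))" for a b :: nat
  by (induction b) (simp_all add: mult.assoc)

text \<open>The triangular power of \<open>q\<close> in front of \<open>scalar_prod\<close> is left
  out; it is split separately.\<close>

definition sp_weight :: "real \<Rightarrow> real list \<Rightarrow> nat \<Rightarrow> nat list \<Rightarrow> real" where
  "sp_weight q \<alpha> M x = (\<Prod>i<length \<alpha>. qpoch (q * \<alpha> ! i) q (x ! i) / qpoch q q (x ! i)
                   * (\<alpha> ! i * q) ^ (M - psum x (Suc i)))"

text \<open>In the first block every exponent grows by \<open>K\<close>, and these extra factors
  multiply to the power of \<open>prod_list \<beta> * q ^ length \<beta>\<close>. In the second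
  block the total \<open>M\<close> of the first cancels from the exponent.\<close>

lemma sp_weight_append:
  assumes x: "x \<in> tuples (length \<beta>) M" and y: "y \<in> tuples (length \<gamma>) K"
  shows "sp_weight q (\<beta> @ \<gamma>) (M + K) (x @ y)
         = (prod_list \<beta> * q ^ length \<beta>) ^ K * sp_weight q \<beta> M x * sp_weight q \<gamma> K y"
proof -
  have len: "length x = length \<beta>" "length y = length \<gamma>" and sum: "sum_list x = M"
    using x y by (auto simp: tuples_def)
  have "psum x k \<le> M" for k
    unfolding psum_def sum[symmetric] by (metis append_take_drop_id le_add1 sum_list_append)
  then have "M + K - psum x k = (M - psum x k) + K" for k
    by simp
  then have "(\<Prod>i<length \<beta>. qpoch (q * (\<beta> @ \<gamma>) ! i) q ((x @ y) ! i) / qpoch q q ((x @ y) ! i)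
                   * ((\<beta> @ \<gamma>) ! i * q) ^ (M + K - psum (x @ y) (Suc i)))
      = (\<Prod>i<length \<beta>. (\<beta> ! i * q) ^ K * (qpoch (q * \<beta> ! i) q (x ! i) / qpoch q q (x ! i)
                   * (\<beta> ! i * q) ^ (M - psum x (Suc i))))"
    using len by (intro prod.cong) (simp_all add: nth_append psum_def power_add)
  also have "\<dots> = (\<Prod>i<length \<beta>. \<beta> ! i * q) ^ K * sp_weight q \<beta> M x"
    unfolding prod.distrib[of "\<lambda>i. (\<beta> ! i * q) ^ K"] prod_power_distrib by (simp add: sp_weight_def)
  also have "(\<Prod>i<length \<beta>. \<beta> ! i * q) = prod_list \<beta> * q ^ length \<beta>"
    by (simp add: prod.distrib prod.list_conv_set_nth atLeast0LessThan)
  finally have left: "(\<Prod>i<length \<beta>. qpoch (q * (\<beta> @ \<gamma>) ! i) q ((x @ y) ! i) / qpoch q q ((x @ y) ! i)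
                   * ((\<beta> @ \<gamma>) ! i * q) ^ (M + K - psum (x @ y) (Suc i)))
      = (prod_list \<beta> * q ^ length \<beta>) ^ K * sp_weight q \<beta> M x" .
  have right: "(\<Prod>i<length \<gamma>. qpoch (q * (\<beta> @ \<gamma>) ! (length \<beta> + i)) q ((x @ y) ! (length \<beta> + i))
                     / qpoch q q ((x @ y) ! (length \<beta> + i))
                   * ((\<beta> @ \<gamma>) ! (length \<beta> + i) * q) ^ (M + K - psum (x @ y) (Suc (length \<beta> + i))))
      = sp_weight q \<gamma> K y"
    using len sum unfolding sp_weight_def by (intro prod.cong) (auto simp: nth_append psum_def Suc_diff_le)
  show ?thesis
    unfolding sp_weight_def[of q "\<beta> @ \<gamma>"] length_append prod_lessThan_add left right ..
qed

lemma scalar_prod_split: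
  fixes c d :: "nat \<Rightarrow> real" and u v :: "nat \<Rightarrow> nat list \<Rightarrow> complex"
  assumes t: "t \<le> length \<alpha>"
    and f: "\<And>x. x \<in> tuples (length \<alpha>) N \<Longrightarrow>
              f x = of_real (c (psum x t)) * u (psum x t) (take t x) * v (N - psum x t) (drop t x)"
    and g: "\<And>x. x \<in> tuples (length \<alpha>) N \<Longrightarrow>
              g x = of_real (d (psum x t)) * u (psum x t) (take t x) * v (N - psum x t) (drop t x)"
  shows "scalar_prod q \<alpha> N f g =
           (\<Sum>M\<le>N. of_real (q ^ (M * (N - M)) * (pprod \<alpha> t * q ^ t) ^ (N - M) * c M * d M)
              * scalar_prod q (take t \<alpha>) M (u M) (u M)
              * scalar_prod q (drop t \<alpha>) (N - M) (v (N - M)) (v (N - M)))"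
proof -
  define \<beta> \<gamma> where "\<beta> = take t \<alpha>" and "\<gamma> = drop t \<alpha>"
  have \<alpha>: "\<alpha> = \<beta> @ \<gamma>" "length \<beta> = t" "pprod \<alpha> t = prod_list \<beta>"
    using t by (simp_all add: \<beta>_def \<gamma>_def pprod_def)
  have "scalar_prod q \<alpha> N f g
      = of_real (q ^ (N * (N + 1) div 2)) * (\<Sum>x\<in>tuples (t + length \<gamma>) N. of_real (sp_weight q \<alpha> N x) * f x * cnj (g x))"
    by (simp add: scalar_prod_def sp_weight_def \<alpha>)
  also have "\<dots> = (\<Sum>M\<le>N. \<Sum>y\<in>tuples t M. \<Sum>z\<in>tuples (length \<gamma>) (N - M).
      of_real (q ^ (N * (N + 1) div 2)) * (of_real (sp_weight q \<alpha> N (y @ z)) * f (y @ z) * cnj (g (y @ z))))"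
    unfolding sum_tuples_append sum_distrib_left ..
  also have "\<dots> = (\<Sum>M\<le>N. \<Sum>y\<in>tuples t M. \<Sum>z\<in>tuples (length \<gamma>) (N - M).
      of_real (q ^ (M * (N - M)) * (pprod \<alpha> t * q ^ t) ^ (N - M) * c M * d M)
      * (of_real (q ^ (M * (M + 1) div 2)) * (of_real (sp_weight q \<beta> M y) * u M y * cnj (u M y)))
      * (of_real (q ^ ((N - M) * (N - M + 1) div 2))
           * (of_real (sp_weight q \<gamma> (N - M) z) * v (N - M) z * cnj (v (N - M) z))))"
  proof (intro sum.cong refl)
    fix M y z assume *: "M \<in> {..N}" "y \<in> tuples t M" "z \<in> tuples (length \<gamma>) (N - M)"
    then obtain K where N: "N = M + K"
      by (auto dest: le_Suc_ex)
    have K: "N - M = K"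
      by (simp add: N)
    have "y @ z \<in> tuples (length \<alpha>) N"
      using * by (auto simp: tuples_def \<alpha>)
    note fg = f[OF this] g[OF this]
    have y: "length y = t" "sum_list y = M"
      using * by (auto simp: tuples_def)
    have w: "sp_weight q \<alpha> N (y @ z) = (pprod \<alpha> t * q ^ t) ^ K * sp_weight q \<beta> M y * sp_weight q \<gamma> K z"
      using sp_weight_append[of y \<beta> M z \<gamma> K q] * \<alpha> by (simp add: N)
    \<comment> \<open>Evenness makes each \<open>div 2\<close> exact, so the identity below can be
      halved termwise; the cross term \<open>M K\<close> is the source of
      \<open>q^(M (N-M))\<close>.\<close>
    have "even (M * (M + 1))" "even (K * (K + 1))"
      by simp_all
    moreover have "N * (N + 1) = 2 * (M * K) + M * (M + 1) + K * (K + 1)"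
      by (simp add: N algebra_simps)
    ultimately have "N * (N + 1) div 2 = M * K + M * (M + 1) div 2 + K * (K + 1) div 2"
      by presburger
    then have "q ^ (N * (N + 1) div 2) = q ^ (M * K) * q ^ (M * (M + 1) div 2) * q ^ (K * (K + 1) div 2)"
      by (simp only: power_add)
    then show "of_real (q ^ (N * (N + 1) div 2)) * (of_real (sp_weight q \<alpha> N (y @ z)) * f (y @ z) * cnj (g (y @ z)))
      = of_real (q ^ (M * (N - M)) * (pprod \<alpha> t * q ^ t) ^ (N - M) * c M * d M)
      * (of_real (q ^ (M * (M + 1) div 2)) * (of_real (sp_weight q \<beta> M y) * u M y * cnj (u M y)))
      * (of_real (q ^ ((N - M) * (N - M + 1) div 2))
           * (of_real (sp_weight q \<gamma> (N - M) z) * v (N - M) z * cnj (v (N - M) z)))"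
      unfolding fg w K using y by (simp add: psum_def K mult_ac)
  qed
  also have "\<dots> = (\<Sum>M\<le>N. of_real (q ^ (M * (N - M)) * (pprod \<alpha> t * q ^ t) ^ (N - M) * c M * d M)
              * scalar_prod q \<beta> M (u M) (u M)
              * scalar_prod q \<gamma> (N - M) (v (N - M)) (v (N - M)))"
    unfolding scalar_prod_def sp_weight_def[symmetric]
    unfolding \<alpha>(2) sum_distrib_left[symmetric] sum_distrib_right[symmetric] ..
  finally show ?thesis
    unfolding \<beta>_def \<gamma>_def .
qed

section \<open>The norm of the product basis\<close>

lemma prod_list_scaled_less_1:
  fixes c :: real
  assumes "\<beta> \<noteq> []" and "\<And>a. a \<in> set \<beta> \<Longrightarrow> 0 < a \<and> a * c < 1" and "0 < c"
  shows "prod_list \<beta> * c ^ length \<beta> < 1"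
proof -
  have "(\<Prod>a\<leftarrow>\<beta>. a * c) < 1 \<and> 0 < (\<Prod>a\<leftarrow>\<beta>. a * c)"
    using assms
  proof (induction \<beta> rule: list_nonempty_induct)
    case (cons a \<beta>)
    then have "(a * c) * (\<Prod>a\<leftarrow>\<beta>. a * c) < 1 * 1"
      by (intro mult_strict_mono) auto
    then show ?case
      using cons by simp
  qed auto
  moreover have "(\<Prod>a\<leftarrow>\<beta>. a * c) = prod_list \<beta> * c ^ length \<beta>"
    by (induction \<beta>) (simp_all add: mult_ac)
  ultimately show ?thesis
    by simp
qed

lemma prod_list_scaled_greater_1:
  fixes c :: real
  assumes "\<beta> \<noteq> []" and "\<And>a. a \<in> set \<beta> \<Longrightarrow> 1 < a * c"
  shows "1 < prod_list \<beta> * c ^ length \<beta>"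
proof -
  have "1 < (\<Prod>a\<leftarrow>\<beta>. a * c)"
    using assms
  proof (induction \<beta> rule: list_nonempty_induct)
    case (cons a \<beta>)
    then have "1 < a * c" "1 < (\<Prod>a\<leftarrow>\<beta>. a * c)"
      by auto
    then have "1 * 1 < (a * c) * (\<Prod>a\<leftarrow>\<beta>. a * c)"
      by (intro mult_strict_mono) auto
    then show ?case
      using cons by simp
  qed auto
  also have "(\<Prod>a\<leftarrow>\<beta>. a * c) = prod_list \<beta> * c ^ length \<beta>"
    by (induction \<beta>) (simp_all add: mult_ac)
  finally show ?thesis .
qed

text \<open>For \<open>\<beta>\<close> the first \<open>t\<close> parameters, these are the
  denominators \<open>(a q;q)_k\<close> of the q-Hahn polynomials. Small parameters satisfy
  \<open>\<alpha> q < 1\<close>, which keeps the product with any further power of \<open>q\<close>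
  below 1. Large ones satisfy \<open>\<alpha> q^N > 1\<close>, which keeps it above 1 as long as the
  exponent is at most \<open>N * length \<beta>\<close>.\<close>

lemma qpoch_prod_list_nz:
  assumes q: "0 < q" "q < 1" and "\<beta> \<noteq> []"
    and \<beta>: "(\<forall>a\<in>set \<beta>. 0 < a \<and> a < inverse q) \<or> (\<forall>a\<in>set \<beta>. a > q powi (- int N))"
    and i: "i + L \<le> N" "length \<beta> = 1 \<Longrightarrow> i = 0"
  shows "qpoch (prod_list \<beta> * q ^ (length \<beta> + 2 * i)) q L \<noteq> 0"
proof -
  have "prod_list \<beta> * q ^ (length \<beta> + 2 * i) * q ^ k \<noteq> 1" if "k < L" for k
    using \<beta>
  proof
    assume *: "\<forall>a\<in>set \<beta>. 0 < a \<and> a < inverse q"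
    then have "prod_list \<beta> * q ^ length \<beta> < 1"
      using \<open>\<beta> \<noteq> []\<close> q by (intro prod_list_scaled_less_1) (auto simp: field_simps)
    moreover have "prod_list \<beta> > 0"
      using * by (induction \<beta>) auto
    moreover have "q ^ (2 * i + k) \<le> 1"
      using q by (intro power_le_one) auto
    ultimately have "prod_list \<beta> * q ^ length \<beta> * q ^ (2 * i + k) < 1"
      using q by (smt (verit) mult_left_le zero_less_mult_iff zero_less_power)
    then show ?thesis
      by (simp add: power_add mult_ac)
  next
    assume *: "\<forall>a\<in>set \<beta>. a > q powi (- int N)"
    then have "1 < prod_list \<beta> * (q ^ N) ^ length \<beta>"
      using \<open>\<beta> \<noteq> []\<close> q by (intro prod_list_scaled_greater_1) (auto simp: power_int_minus field_simps)
    also have "\<dots> \<le> prod_list \<beta> * q ^ (length \<beta> + 2 * i + k)"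
    proof (rule mult_left_mono)
      \<comment> \<open>For one parameter, \<open>i = 0\<close> gives
        \<open>1 + k \<le> L \<le> N\<close>. For \<open>s + 2\<close> parameters, add
        \<open>s \<le> N s\<close> and
        \<open>2 + 2 i + k \<le> 2 (i + k + 1) \<le> 2 N\<close>.\<close>
      have "length \<beta> + 2 * i + k \<le> N * length \<beta>"
      proof (cases "length \<beta> = 1")
        case False
        define s where "s = length \<beta> - 2"
        have s: "length \<beta> = s + 2"
          using False \<open>\<beta> \<noteq> []\<close> by (cases \<beta> rule: remdups_adj.cases) (auto simp: s_def)
        have "s \<le> N * s"
          using that i by (cases N) auto
        moreover have "N * length \<beta> = N * s + 2 * N"
          by (simp add: s)
        ultimately show ?thesis
          using that i s by linarith
      qed (use that i in auto)
      then show "(q ^ N) ^ length \<beta> \<le> q ^ (length \<beta> + 2 * i + k)"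
        using q unfolding power_mult[symmetric] by (intro power_decreasing) auto
      have "a \<ge> 0" if "a \<in> set \<beta>" for a
        using * that zero_less_power_int[OF q(1), of "- int N"] by (meson less_imp_le order.strict_trans)
      then show "0 \<le> prod_list \<beta>"
        by (induction \<beta>) auto
    qed
    finally show ?thesis
      by (simp add: power_add mult_ac)
  qed
  then show ?thesis
    by (auto simp: qpoch_eq_0_iff)
qed

text \<open>The powers of \<open>q\<close> at \<open>M = i + x\<close>, \<open>N - M = j + y\<close>: what remains besides the weight
  \<open>(A q\<^sup>t\<^sup>+\<^sup>2\<^sup>i)\<^sup>y\<close> depends on \<open>x + y\<close> only.\<close>

lemma q_exponents:
  fixes q A :: real
  assumes "0 < q"
  shows "q ^ ((i + x) * (j + y)) * (A * q ^ t) ^ (j + y) * (q powi (- int j * int (i + x)))\<^sup>2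
      * q powr (((real (i + x) - 2 * real i)\<^sup>2 + real (i + x) + 2 * real i - 2 * (real i)\<^sup>2) / 2)
      * q powr (((real (j + y) - 2 * real j)\<^sup>2 + real (j + y) + 2 * real j - 2 * (real j)\<^sup>2) / 2)
    = (A * q ^ (t + 2 * i)) ^ j * (A * q ^ (t + 2 * i)) ^ y
      * q powr (((real (x + y))\<^sup>2 + real (x + y) - 2 * real (i + j) * real (x + y)
                 + 3 * real (i + j) - (real (i + j))\<^sup>2) / 2 - 2 * real i * real j)"
    (is "_ * _ * _ * q powr ?e1 * q powr ?e2 = _ * _ * q powr ?E")
proof -
  have "(q powi (- int j * int (i + x)))\<^sup>2 = q powr (- 2 * real j * real (i + x))"
  proof -
    have "q powi (- int j * int (i + x)) = q powr (- real j * real (i + x))"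
      using assms powr_real_of_int'[of q "- int j * int (i + x)"] by simp
    then show ?thesis
      by (simp add: power2_eq_square algebra_simps flip: powr_add)
  qed
  moreover have "q ^ ((i + x) * (j + y)) = q powr (real (i + x) * real (j + y))"
    using assms by (simp flip: powr_realpow)
  \<comment> \<open>No sign of \<open>A\<close> is assumed, so powers of \<open>A q^t\<close> remain
    natural powers and only those of \<open>q\<close> pass to \<open>powr\<close>.\<close>
  moreover have "(A * q ^ (t + 2 * i)) ^ j * (A * q ^ (t + 2 * i)) ^ y
      = (A * q ^ t) ^ (j + y) * q powr (2 * real i * real (j + y))"
  proof -
    have "(A * q ^ (t + 2 * i)) ^ (j + y) = (A * q ^ t) ^ (j + y) * q ^ (2 * i * (j + y))"
      unfolding power_add[of q t] mult.assoc[symmetric] power_mult_distrib[of "A * q ^ t"]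
        power_mult[of q "2 * i"] ..
    also have "q ^ (2 * i * (j + y)) = q powr (2 * real i * real (j + y))"
      using assms by (simp flip: powr_realpow)
    finally show ?thesis
      by (simp add: power_add)
  qed
  moreover have "q powr (real (i + x) * real (j + y)) * q powr (- 2 * real j * real (i + x)) * q powr ?e1 * q powr ?e2
      = q powr (2 * real i * real (j + y)) * q powr ?E"
    unfolding powr_add[symmetric]
    by (rule arg_cong[where f = "\<lambda>e. q powr e"]) (simp add: power2_eq_square field_simps)
  ultimately show ?thesis
    by (simp add: mult_ac)
qed

theorem theorem4p5:
  fixes q :: real and \<alpha> :: "real list" and h N t i j n m :: nat
    and f' f'' :: "nat \<Rightarrow> nat list \<Rightarrow> complex"
    and f g :: "nat list \<Rightarrow> complex"
    and \<Gamma>' \<Gamma>'' :: real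
    and \<psi> :: "nat \<Rightarrow> nat \<Rightarrow> nat \<Rightarrow> real"
  assumes "0 < q" "q < 1"
    and "2 \<le> h" "1 \<le> N"
    and "length \<alpha> = h"
    and "(\<forall>a\<in>set \<alpha>. 0 < a \<and> a < inverse q) \<or> (\<forall>a\<in>set \<alpha>. a > q powi (- int N))"
    and "1 \<le> t" "t \<le> h - 1"
    and "i + j \<le> N" "t = 1 \<Longrightarrow> i = 0" "t = h - 1 \<Longrightarrow> j = 0"
    and "\<And>M. i \<le> M \<Longrightarrow> M \<le> N - j \<Longrightarrow> f' M \<in> V t M"
    and "\<And>M. i \<le> M \<Longrightarrow> M \<le> N - j \<Longrightarrow> f'' (N - M) \<in> V (h - t) (N - M)"
    and "\<And>M. i \<le> M \<Longrightarrow> M \<le> N - j \<Longrightarrow>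
           scalar_prod q (take t \<alpha>) M (f' M) (f' M) =
             of_real (\<Gamma>' * (qpoch (pprod \<alpha> t * q ^ (t + 2 * i)) q (M - i) / qpoch q q (M - i))
               * q powr (((real M - 2 * real i)\<^sup>2 + real M + 2 * real i - 2 * (real i)\<^sup>2) / 2))"
    and "\<And>M. i \<le> M \<Longrightarrow> M \<le> N - j \<Longrightarrow>
           scalar_prod q (drop t \<alpha>) (N - M) (f'' (N - M)) (f'' (N - M)) =
             of_real (\<Gamma>'' * (qpoch (pprod \<alpha> h * inverse (pprod \<alpha> t) * q ^ (h - t + 2 * j)) q (N - M - j)
                             / qpoch q q (N - M - j))
               * q powr (((real N - real M - 2 * real j)\<^sup>2 + real N - real M
                            + 2 * real j - 2 * (real j)\<^sup>2) / 2))"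
    and "i + j \<le> n" "n \<le> N" "i + j \<le> m" "m \<le> N"
    and "\<And>k M. k \<in> {n, m} \<Longrightarrow> i \<le> M \<Longrightarrow> M \<le> N - j \<Longrightarrow>
           \<psi> (k - i - j) M (N - M) =
             qHahn (k - i - j) (M - i) (pprod \<alpha> t * q ^ (t + 2 * i - 1))
               (pprod \<alpha> h * inverse (pprod \<alpha> t) * q ^ (h - t + 2 * j - 1)) (N - i - j) q"
    and "f \<in> V h N" "g \<in> V h N"
    and "\<And>x. x \<in> tuples h N \<Longrightarrow>
           f x = (let X = psum x t in
                  if i \<le> X \<and> X \<le> N - j
                  then of_real (q powi (- int j * int X)) * of_real (\<psi> (n - i - j) X (N - X))
                         * f' X (take t x) * f'' (N - X) (drop t x)
                  else 0)"
    and "\<And>x. x \<in> tuples h N \<Longrightarrow>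
           g x = (let X = psum x t in
                  if i \<le> X \<and> X \<le> N - j
                  then of_real (q powi (- int j * int X)) * of_real (\<psi> (m - i - j) X (N - X))
                         * f' X (take t x) * f'' (N - X) (drop t x)
                  else 0)"
  shows "scalar_prod q \<alpha> N f g =
           of_real ((if n = m then 1 else 0) * Gamma_const q \<alpha> t i j n \<Gamma>' \<Gamma>''
             * (qpoch (pprod \<alpha> h * q ^ (h + 2 * n)) q (N - n) / qpoch q q (N - n))
             * q powr (((real N - 2 * real n)\<^sup>2 + real N + 2 * real n - 2 * (real n)\<^sup>2) / 2))"
proof -
  note q = assms(1,2)
  define A where "A = pprod \<alpha> t"
  define A' where "A' = pprod \<alpha> h * inverse A"
  define a where "a = A * q ^ (t + 2 * i - 1)"
  define b where "b = A' * q ^ (h - t + 2 * j - 1)"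
  define L where "L = N - i - j"
  \<comment> \<open>The extension by 0 gives \<open>f\<close> and \<open>g\<close> the product form
    required by \<open>scalar_prod_split\<close> for every value of \<open>X_t\<close>.\<close>
  define c where "c k M = (if i \<le> M \<and> M \<le> N - j
      then q powi (- int j * int M) * qHahn (k - i - j) (M - i) a b L q else 0)" for k M
  have N: "N = i + L + j"
    using assms(9) by (simp add: L_def)
  have pos: "0 < x" if "x \<in> set \<alpha>" for x
    using assms(6) that zero_less_power_int[OF q(1), of "- int N"] by (meson order.strict_trans)
  have "0 < prod_list \<beta>" if "set \<beta> \<subseteq> set \<alpha>" for \<beta>
    using that by (induction \<beta>) (auto simp: pos)
  then have "0 < A" "0 < pprod \<alpha> h"
    using set_take_subset[of t \<alpha>] set_take_subset[of h \<alpha>] by (auto simp: A_def pprod_def)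
  then have "0 < A'" "b \<noteq> 0" and A': "A * A' = pprod \<alpha> h"
    using q by (auto simp: A'_def b_def)
  \<comment> \<open>Since \<open>1 \<le> t \<le> h - 1\<close>, neither subtraction of 1 is
    truncated.\<close>
  have "t + 2 * i = Suc (t + 2 * i - 1)" "h - t + 2 * j = Suc (h - t + 2 * j - 1)"
    using assms(3,7,8) by simp_all
  then have aq: "a * q = A * q ^ (t + 2 * i)" and bq: "b * q = A' * q ^ (h - t + 2 * j)"
    unfolding a_def b_def by (metis mult.assoc power_Suc2)+
  have ab: "a * b * q ^ k = pprod \<alpha> h * q ^ (h + 2 * i + 2 * j + k - 2)" for k
  proof -
    have "h + 2 * i + 2 * j + k - 2 = (t + 2 * i - 1) + (h - t + 2 * j - 1) + k"
      using assms(3,7,8) by simp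
    then show ?thesis
      unfolding a_def b_def A'[symmetric] by (simp only: power_add mult_ac)
  qed
  have nz: "qpoch (a * q) q L \<noteq> 0"
  proof -
    have "take t \<alpha> \<noteq> []" "length (take t \<alpha>) = t"
      using assms(3,5,7,8) by auto
    moreover have "(\<forall>a\<in>set (take t \<alpha>). 0 < a \<and> a < inverse q) \<or> (\<forall>a\<in>set (take t \<alpha>). a > q powi (- int N))"
      using assms(6) set_take_subset[of t \<alpha>] by blast
    ultimately show ?thesis
      using qpoch_prod_list_nz[OF q, of "take t \<alpha>" N i L] assms(10)
      by (simp add: aq A_def pprod_def N)
  qed
  have "scalar_prod q \<alpha> N f g
      = (\<Sum>M\<le>N. of_real (q ^ (M * (N - M)) * (A * q ^ t) ^ (N - M) * c n M * c m M)
              * scalar_prod q (take t \<alpha>) M (f' M) (f' M)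
              * scalar_prod q (drop t \<alpha>) (N - M) (f'' (N - M)) (f'' (N - M)))"
    unfolding A_def
  proof (rule scalar_prod_split)
    show "t \<le> length \<alpha>"
      using assms(5,8) by simp
    show "f x = of_real (c n (psum x t)) * f' (psum x t) (take t x) * f'' (N - psum x t) (drop t x)"
      if "x \<in> tuples (length \<alpha>) N" for x
      using assms(23)[of x] assms(20)[of n "psum x t"] that
      by (simp add: Let_def c_def assms(5) a_def b_def A_def A'_def L_def)
    show "g x = of_real (c m (psum x t)) * f' (psum x t) (take t x) * f'' (N - psum x t) (drop t x)"
      if "x \<in> tuples (length \<alpha>) N" for x
      using assms(24)[of x] assms(20)[of m "psum x t"] that
      by (simp add: Let_def c_def assms(5) a_def b_def A_def A'_def L_def)
  qed
  also have "\<dots> = (\<Sum>M\<in>{i..N - j}. of_real (q ^ (M * (N - M)) * (A * q ^ t) ^ (N - M) * c n M * c m M)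
              * scalar_prod q (take t \<alpha>) M (f' M) (f' M)
              * scalar_prod q (drop t \<alpha>) (N - M) (f'' (N - M)) (f'' (N - M)))"
    by (rule sum.mono_neutral_right) (auto simp: c_def)
  also have "\<dots> = (\<Sum>x\<le>L. of_real (q ^ ((i + x) * (N - (i + x))) * (A * q ^ t) ^ (N - (i + x)) * c n (i + x) * c m (i + x))
              * scalar_prod q (take t \<alpha>) (i + x) (f' (i + x)) (f' (i + x))
              * scalar_prod q (drop t \<alpha>) (N - (i + x)) (f'' (N - (i + x))) (f'' (N - (i + x))))"
    by (rule sum.reindex_bij_witness[of _ "\<lambda>x. i + x" "\<lambda>M. M - i"]) (auto simp: N)
  \<comment> \<open>With \<open>M = i + x\<close> and \<open>N - M = j + y\<close>, the two norms
    supply the quotients \<open>(a q;q)_x/(q;q)_x\<close> and \<open>(b q;q)_y/(q;q)_y\<close> of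
    \<open>hahn_weight\<close>. By \<open>q_exponents\<close> the powers give its last factor
    \<open>(a q)^y\<close> and a constant.\<close>
  also have "\<dots> = (\<Sum>x\<le>L. of_real (\<Gamma>' * \<Gamma>'' * (a * q) ^ j
      * q powr (((real L)\<^sup>2 + real L - 2 * real (i + j) * real L
                 + 3 * real (i + j) - (real (i + j))\<^sup>2) / 2 - 2 * real i * real j)
      * (hahn_weight q (a * q) (b * q) L x * qHahn (n - i - j) x a b L q * qHahn (m - i - j) x a b L q)))"
  proof (rule sum.cong)
    fix x assume "x \<in> {..L}"
    then obtain y where L: "L = x + y"
      by (auto dest: le_Suc_ex)
    \<comment> \<open>\<open>real_diff\<close> has two forms because \<open>real N - real M\<close>
      also occurs after a left-associated sum.\<close>
    have M: "i \<le> i + x" "i + x \<le> N - j" and diff: "N - (i + x) = j + y" "N - (i + x) - j = y" "L - x = y"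
      and real_diff: "real N - real (i + x) = real (j + y)" "r + real N - real (i + x) = r + real (j + y)" for r
      by (auto simp: N L)
    have norm': "scalar_prod q (take t \<alpha>) (i + x) (f' (i + x)) (f' (i + x))
        = of_real (\<Gamma>' * (qpoch (a * q) q x / qpoch q q x)
           * q powr (((real (i + x) - 2 * real i)\<^sup>2 + real (i + x) + 2 * real i - 2 * (real i)\<^sup>2) / 2))"
      using assms(14)[OF M] unfolding aq A_def by simp
    have norm'': "scalar_prod q (drop t \<alpha>) (N - (i + x)) (f'' (N - (i + x))) (f'' (N - (i + x)))
        = of_real (\<Gamma>'' * (qpoch (b * q) q y / qpoch q q y)
           * q powr (((real (j + y) - 2 * real j)\<^sup>2 + real (j + y) + 2 * real j - 2 * (real j)\<^sup>2) / 2))"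
      using assms(15)[OF M] unfolding bq A'_def A_def diff(2) real_diff .
    have "q ^ ((i + x) * (j + y)) * (A * q ^ t) ^ (j + y) * c n (i + x) * c m (i + x)
        * (\<Gamma>' * (qpoch (a * q) q x / qpoch q q x)
           * q powr (((real (i + x) - 2 * real i)\<^sup>2 + real (i + x) + 2 * real i - 2 * (real i)\<^sup>2) / 2))
        * (\<Gamma>'' * (qpoch (b * q) q y / qpoch q q y)
           * q powr (((real (j + y) - 2 * real j)\<^sup>2 + real (j + y) + 2 * real j - 2 * (real j)\<^sup>2) / 2))
      = \<Gamma>' * \<Gamma>'' * (qpoch (a * q) q x / qpoch q q x) * (qpoch (b * q) q y / qpoch q q y)
        * qHahn (n - i - j) x a b L q * qHahn (m - i - j) x a b L q
        * (q ^ ((i + x) * (j + y)) * (A * q ^ t) ^ (j + y) * (q powi (- int j * int (i + x)))\<^sup>2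
      * q powr (((real (i + x) - 2 * real i)\<^sup>2 + real (i + x) + 2 * real i - 2 * (real i)\<^sup>2) / 2)
      * q powr (((real (j + y) - 2 * real j)\<^sup>2 + real (j + y) + 2 * real j - 2 * (real j)\<^sup>2) / 2))"
      using M unfolding c_def power2_eq_square[of "q powi _"] by simp
    also have "\<dots> = \<Gamma>' * \<Gamma>'' * (a * q) ^ j
      * q powr (((real L)\<^sup>2 + real L - 2 * real (i + j) * real L
                 + 3 * real (i + j) - (real (i + j))\<^sup>2) / 2 - 2 * real i * real j)
      * (hahn_weight q (a * q) (b * q) L x * qHahn (n - i - j) x a b L q * qHahn (m - i - j) x a b L q)"
      unfolding q_exponents[OF q(1)] hahn_weight_def aq[symmetric] diff L[symmetric] by (simp only: mult_ac)
    finally show "of_real (q ^ ((i + x) * (N - (i + x))) * (A * q ^ t) ^ (N - (i + x)) * c n (i + x) * c m (i + x))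
              * scalar_prod q (take t \<alpha>) (i + x) (f' (i + x)) (f' (i + x))
              * scalar_prod q (drop t \<alpha>) (N - (i + x)) (f'' (N - (i + x))) (f'' (N - (i + x)))
        = of_real (\<Gamma>' * \<Gamma>'' * (a * q) ^ j
      * q powr (((real L)\<^sup>2 + real L - 2 * real (i + j) * real L
                 + 3 * real (i + j) - (real (i + j))\<^sup>2) / 2 - 2 * real i * real j)
      * (hahn_weight q (a * q) (b * q) L x * qHahn (n - i - j) x a b L q * qHahn (m - i - j) x a b L q))"
      unfolding norm' norm'' unfolding diff of_real_mult[symmetric] by (simp only:)
  qed simp
  also have "\<dots> = of_real (\<Gamma>' * \<Gamma>'' * (a * q) ^ j
      * q powr (((real L)\<^sup>2 + real L - 2 * real (i + j) * real L
                 + 3 * real (i + j) - (real (i + j))\<^sup>2) / 2 - 2 * real i * real j)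
      * (\<Sum>x\<le>L. hahn_weight q (a * q) (b * q) L x * qHahn (n - i - j) x a b L q * qHahn (m - i - j) x a b L q))"
    unfolding sum_distrib_left of_real_sum ..
  also have "(\<Sum>x\<le>L. hahn_weight q (a * q) (b * q) L x * qHahn (n - i - j) x a b L q * qHahn (m - i - j) x a b L q)
      = (if n = m then 1 else 0) * q powr ((real (n - i - j))\<^sup>2 - 2 * real (n - i - j) * real L)
           * (a * q) ^ (n - i - j) * qpoch q q (n - i - j)
           * (qpoch (a * b * q ^ (n - i - j + 1)) q (n - i - j) * qpoch (b * q) q (n - i - j) / qpoch (a * q) q (n - i - j))
           * (qpoch (a * b * q ^ (2 * (n - i - j) + 2)) q (L - (n - i - j)) / qpoch q q (L - (n - i - j)))"
  proof -
    \<comment> \<open>Truncated subtraction is injective here because \<open>i + j\<close> is at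
      most \<open>n\<close> and \<open>m\<close>.\<close>
    have "n - i - j = m - i - j \<longleftrightarrow> n = m"
      using assms(16,18) by auto
    then show ?thesis
      using qHahn_orthogonal[OF q _ _ nz \<open>b \<noteq> 0\<close>, of "n - i - j" "m - i - j"] assms(16-19)
      by (simp add: L_def)
  qed
  also have "\<Gamma>' * \<Gamma>'' * (a * q) ^ j
      * q powr (((real L)\<^sup>2 + real L - 2 * real (i + j) * real L
                 + 3 * real (i + j) - (real (i + j))\<^sup>2) / 2 - 2 * real i * real j) * \<dots>
    = (if n = m then 1 else 0) * Gamma_const q \<alpha> t i j n \<Gamma>' \<Gamma>''
             * (qpoch (pprod \<alpha> h * q ^ (h + 2 * n)) q (N - n) / qpoch q q (N - n))
             * q powr (((real N - 2 * real n)\<^sup>2 + real N + 2 * real n - 2 * (real n)\<^sup>2) / 2)"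
  proof -
    define n' where "n' = n - i - j"
    have n: "n = n' + i + j" "n - i - j = n'" "n - i = n' + j" "L - n' = N - n"
      using assms(16) by (auto simp: n'_def L_def)
    \<comment> \<open>Both sides differ only in how one power of \<open>q\<close> is distributed:
      \<open>p\<^sub>1\<close> belongs to \<open>\<Gamma>\<close> and \<open>p\<^sub>2\<close> is
      the power in the claimed norm.\<close>
    have rearrange: "G * G' * s * e\<^sub>1 * (d * e\<^sub>2 * r * Q * (X * Y / Z) * (U / W))
        = d * (G * G' * (Q * X * Y / Z) * (r * s) * p\<^sub>1) * (U / W) * p\<^sub>2"
      if "e\<^sub>1 * e\<^sub>2 = p\<^sub>1 * p\<^sub>2" for G G' s e\<^sub>1 d e\<^sub>2 r Q X Y Z U W p\<^sub>1 p\<^sub>2 :: real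
    proof -
      have "G * G' * s * e\<^sub>1 * (d * e\<^sub>2 * r * Q * (X * Y / Z) * (U / W))
          = (e\<^sub>1 * e\<^sub>2) * (d * (G * G' * (Q * X * Y / Z) * (r * s)) * (U / W))"
        by (simp only: divide_inverse mult_ac)
      then show ?thesis
        unfolding that by (simp only: divide_inverse mult_ac)
    qed
    have powi: "q powi (- 2 * int i * int j - (int n - int i - int j)) = q powr (- 2 * real i * real j - real n')"
      using q powr_real_of_int'[of q "- 2 * int i * int j - int n'"] by (simp add: n(1))
    \<comment> \<open>With \<open>N = i + L + j\<close> and \<open>n = n' + i + j\<close> the two
      total exponents agree as polynomials in \<open>i\<close>, \<open>j\<close>, \<open>n'\<close>
      and \<open>L\<close>.\<close>
    have powr: "q powr (((real L)\<^sup>2 + real L - 2 * real (i + j) * real L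
                 + 3 * real (i + j) - (real (i + j))\<^sup>2) / 2 - 2 * real i * real j)
          * q powr ((real n')\<^sup>2 - 2 * real n' * real L)
        = q powr (- 2 * real i * real j - real n')
          * q powr (((real N - 2 * real n)\<^sup>2 + real N + 2 * real n - 2 * (real n)\<^sup>2) / 2)"
      unfolding powr_add[symmetric]
      by (rule arg_cong[where f = "\<lambda>e. q powr e"]) (simp add: n(1) N power2_eq_square field_simps)
    have base: "a * b * q ^ (n' + 1) = pprod \<alpha> h * q ^ (h + n + i + j - 1)"
      "a * b * q ^ (2 * n' + 2) = pprod \<alpha> h * q ^ (h + 2 * n)"
      unfolding ab by (simp_all add: n(1) mult_2 mult_2_right ac_simps)
    show ?thesis
      unfolding Gamma_const_def Let_def assms(5) A_def[symmetric] A'_def[symmetric]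
        aq[symmetric] bq[symmetric] powi n(2)
      unfolding n(3,4) base power_add[of "a * q"] by (rule rearrange[OF powr])
  qed
  finally show ?thesis .
qed

end
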